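(* Let $a<b$, $0<\alpha<1$, and let $f\in H^1(a,b)$ attain its maximum over $[a,b]$ at a point $t_0\in[a,b]$. Then $$({}^{ABC}{}_{a}D^\alpha f)(t_0)\ \ge\ \frac{B(\alpha)}{1-\alpha}\,E_\alpha\!\left[-\frac{\alpha}{1-\alpha}(t_0-a)^\alpha\right]\bigl(f(t_0)-f(a)\bigr)\ \ge\ 0.$$
   Context: All functions are real-valued; a function in the Sobolev space $H^1(a,b)$ is identified with its continuous representative on $[a,b]$. $E_\alpha(z)=\sum_{k\ge 0} z^k/\Gamma(\alpha k+1)$ is the Mittag-Leffler function, and $B$ is a normalization function with $B(\alpha)>0$ and $B(0)=B(1)=1$. For $f\in H^1(a,b)$ and $\alpha\in(0,1)$, the left Caputo fractional derivative with Mittag-Leffler non-singular kernel is $$({}^{ABC}{}_{a}D^\alpha f)(t)=\frac{B(\alpha)}{1-\alpha}\int_a^t E_\alpha\!\left[-\frac{\alpha}{1-\alpha}(t-s)^\alpha\right] f'(s)\,ds,\qquad t\in[a,b].$$ *)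

theory Defs
  imports "HOL-Analysis.Analysis"
begin

definition mittag_leffler :: "real \<Rightarrow> real \<Rightarrow> real" where
  "mittag_leffler \<alpha> z = (\<Sum>k. z ^ k / Gamma (\<alpha> * real k + 1))"

definition L2_on :: "real \<Rightarrow> real \<Rightarrow> (real \<Rightarrow> real) \<Rightarrow> bool" where
  "L2_on a b f \<longleftrightarrow>
     set_borel_measurable lborel {a<..<b} f \<and> set_integrable lborel {a<..<b} (\<lambda>x. (f x)\<^sup>2)"

(* Smooth functions with compact support inside the open interval (a, b). *)
definition test_function :: "real \<Rightarrow> real \<Rightarrow> (real \<Rightarrow> real) \<Rightarrow> bool" where
  "test_function a b \<phi> \<longleftrightarrow>
     (\<forall>n x. (deriv ^^ n) \<phi> differentiable (at x)) \<and>
     compact (closure {x. \<phi> x \<noteq> 0}) \<and> closure {x. \<phi> x \<noteq> 0} \<subseteq> {a<..<b}"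

(* Square integrability of f and g is part of the definition; in particular both integrals
   below converge, so Isabelle's default value for divergent integrals plays no role. *)
definition has_weak_deriv_L2 :: "real \<Rightarrow> real \<Rightarrow> (real \<Rightarrow> real) \<Rightarrow> (real \<Rightarrow> real) \<Rightarrow> bool" where
  "has_weak_deriv_L2 a b f g \<longleftrightarrow>
     L2_on a b f \<and> L2_on a b g \<and>
     (\<forall>\<phi>. test_function a b \<phi> \<longrightarrow>
        (LBINT x:{a<..<b}. f x * deriv \<phi> x) = - (LBINT x:{a<..<b}. g x * \<phi> x))"

(* A set of functions rather than of almost-everywhere classes: f belongs to it iff its class
   belongs to the Sobolev space. The continuous representative is selected by requiring
   continuity on {a..b} in addition. *)
definition sobolev_H1 :: "real \<Rightarrow> real \<Rightarrow> (real \<Rightarrow> real) set" where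
  "sobolev_H1 a b = {f. \<exists>g. has_weak_deriv_L2 a b f g}"

(* Unique up to a null set, so the choice does not affect integrals against it. *)
definition weak_deriv :: "real \<Rightarrow> real \<Rightarrow> (real \<Rightarrow> real) \<Rightarrow> real \<Rightarrow> real" where
  "weak_deriv a b f = (SOME g. has_weak_deriv_L2 a b f g)"

(* The right endpoint b enters only through the interval on which f' is the weak derivative.
   At s = t the kernel is evaluated correctly, as 0 powr \<alpha> = 0. *)
definition abc_caputo ::
    "(real \<Rightarrow> real) \<Rightarrow> real \<Rightarrow> real \<Rightarrow> real \<Rightarrow> (real \<Rightarrow> real) \<Rightarrow> real \<Rightarrow> real" where
  "abc_caputo B \<alpha> a b f t =
     B \<alpha> / (1 - \<alpha>) *
     (LBINT s:{a..t}. mittag_leffler \<alpha> (- (\<alpha> / (1 - \<alpha>)) * (t - s) powr \<alpha>) * weak_deriv a b f s)"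

end

theory Submission
  imports Defs
begin

text \<open>
The kernel \<open>k(s) = E\<^sub>\<alpha>(- \<alpha> / (1 - \<alpha>) (t\<^sub>0 - s)\<^sup>\<alpha>)\<close> is nonnegative and nondecreasing on \<open>[a, t\<^sub>0]\<close>.
By the second mean value theorem, some \<open>c\<close> satisfies
\<open>\<integral> k f' = k(a) (f(c) - f(a)) + k(t\<^sub>0) (f(t\<^sub>0) - f(c))\<close> over \<open>[a, t\<^sub>0]\<close>, and
\<open>k(t\<^sub>0) \<ge> k(a)\<close> together with \<open>f(t\<^sub>0) \<ge> f(c)\<close> gives the bound.

That \<open>E\<^sub>\<alpha>(- x)\<close> is nonnegative and nonincreasing for \<open>x \<ge> 0\<close> comes from a discretisation: the
\<open>n\<close>-th coefficient of \<open>(1 - X)\<^sup>\<alpha>\<^sup>-\<^sup>1 / ((1 - X)\<^sup>\<alpha> + \<mu>)\<close> is nonnegative and nonincreasing in \<open>\<mu>\<close>, because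
\<open>(1 - X)\<^sup>\<alpha>\<close> has no positive coefficient besides the constant one, and for \<open>\<mu> = x / n\<^sup>\<alpha>\<close> it tends to
\<open>E\<^sub>\<alpha>(- x)\<close> by Tannery's theorem.

That \<open>f\<close> is the integral of its weak derivative is seen by testing with
\<open>S(n(x - p)) - S(n(x - q))\<close>, where \<open>S\<close> is a smooth step from \<open>0\<close> to \<open>1\<close>: these functions tend to the
indicator of \<open>(p, q]\<close>, and their derivatives to a difference of Dirac masses.
\<close>

section \<open>Monotonicity of the Mittag-Leffler function on the negative axis\<close>

unbundle no vec_syntax and fps_syntax

text \<open>The expansion of \<open>(1 - X)\<^sup>-\<^sup>s\<close>.\<close>

definition neg_binomial_fps :: "real \<Rightarrow> real fps" where
  "neg_binomial_fps s = Abs_fps (\<lambda>n. pochhammer s n / fact n)"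

lemma neg_binomial_fps_nth: "neg_binomial_fps s $ n = pochhammer s n / fact n"
  by (simp add: neg_binomial_fps_def)

lemma neg_binomial_fps_0: "neg_binomial_fps 0 = 1"
  by (simp add: fps_eq_iff neg_binomial_fps_nth pochhammer_0_left)

text \<open>Coefficientwise this is the Vandermonde identity for rising factorials.\<close>

lemma neg_binomial_fps_add:
  "neg_binomial_fps (s + t) = neg_binomial_fps s * neg_binomial_fps t"
proof (rule fps_ext)
  fix n
  have "pochhammer (s + t) n / fact n
      = (\<Sum>k\<le>n. real (n choose k) * pochhammer s k * pochhammer t (n - k) / fact n)"
    by (simp add: pochhammer_binomial_sum sum_divide_distrib)
  also have "\<dots> = (\<Sum>k\<le>n. (pochhammer s k / fact k) * (pochhammer t (n - k) / fact (n - k)))"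
    by (intro sum.cong) (auto simp: binomial_fact field_simps)
  finally show "neg_binomial_fps (s + t) $ n = (neg_binomial_fps s * neg_binomial_fps t) $ n"
    by (simp add: neg_binomial_fps_nth fps_mult_nth atLeast0AtMost)
qed

lemma neg_binomial_fps_nth_nonneg: "s \<ge> 0 \<Longrightarrow> neg_binomial_fps s $ n \<ge> 0"
  by (simp add: neg_binomial_fps_nth pochhammer_prod prod_nonneg)

text \<open>In the rising factorial of \<open>- s\<close> only the first factor \<open>- s\<close>
  is nonpositive; the others start at 1 - s, which is where \<open>s \<le> 1\<close> enters.\<close>

lemma neg_binomial_fps_minus_nth_nonpos:
  assumes "0 \<le> s" "s \<le> 1" "n > 0"
  shows "neg_binomial_fps (- s) $ n \<le> 0"
proof -
  obtain m where n: "n = Suc m" using assms(3) by (cases n) auto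
  have "pochhammer (1 - s) m \<ge> 0"
    using assms by (simp add: pochhammer_prod prod_nonneg)
  then show ?thesis
    using assms by (simp add: neg_binomial_fps_nth n pochhammer_rec divide_nonpos_pos mult_nonpos_nonneg field_simps)
qed

text \<open>A discrete maximum principle: solving the convolution for \<open>G $ n * F $ 0\<close>
  leaves \<open>(G * F) $ n\<close> minus products of earlier coefficients of \<open>G\<close>,
  nonnegative by induction, with nonpositive coefficients of \<open>F\<close>.\<close>

lemma fps_nth_nonneg_if_mult_nonneg:
  fixes F G :: "real fps"
  assumes "F $ 0 > 0" and "\<And>n. n > 0 \<Longrightarrow> F $ n \<le> 0" and "\<And>n. (G * F) $ n \<ge> 0"
  shows "G $ n \<ge> 0"
proof (induction n rule: less_induct)
  case (less n)
  have "(G * F) $ n = (\<Sum>i\<in>insert n {..<n}. G $ i * F $ (n - i))"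
    unfolding fps_mult_nth by (intro sum.cong) auto
  then have "(G * F) $ n = G $ n * F $ 0 + (\<Sum>i<n. G $ i * F $ (n - i))"
    by simp
  moreover have "(\<Sum>i<n. G $ i * F $ (n - i)) \<le> 0"
    using less assms(2) by (intro sum_nonpos mult_nonneg_nonpos) auto
  ultimately have "0 \<le> G $ n * F $ 0" using assms(3)[of n] by linarith
  then show ?case using assms(1) by (simp add: zero_le_mult_iff)
qed

section \<open>Discrete fractional relaxation\<close>

text \<open>For fixed \<open>n\<close> the coefficient grows at most like (k + 1)^n in
  \<open>k\<close>, so the geometric factor wins.\<close>

lemma summable_neg_binomial_fps_nth:
  fixes \<alpha> \<mu> :: real
  assumes "0 \<le> \<alpha>" "\<alpha> \<le> 1" "\<bar>\<mu>\<bar> < 1"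
  shows "summable (\<lambda>k. \<mu> ^ k * neg_binomial_fps (\<alpha> * real k + 1) $ n)"
proof -
  \<comment> \<open>The ratio for the ratio test, strictly between |\<mu>| and 1. The polynomial
    part contributes the factor (1 + 1/(k + 1))^n, which tends to 1.\<close>
  define c where "c = (1 + \<bar>\<mu>\<bar>) / 2"
  have c: "\<bar>\<mu>\<bar> < c" "c < 1" using assms by (auto simp: c_def)
  have "(\<lambda>k. (1 + 1 / real (Suc k)) ^ n * \<bar>\<mu>\<bar>) \<longlonglongrightarrow> (1 + 0) ^ n * \<bar>\<mu>\<bar>"
    by (intro tendsto_intros lim_1_over_n LIMSEQ_Suc)
  then have "eventually (\<lambda>k. (1 + 1 / real (Suc k)) ^ n * \<bar>\<mu>\<bar> < c) sequentially"
    using c by (intro order_tendstoD(2)) auto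
  then obtain K where K: "\<And>k. k \<ge> K \<Longrightarrow> (1 + 1 / real (Suc k)) ^ n * \<bar>\<mu>\<bar> < c"
    by (auto simp: eventually_sequentially)
  have sum: "summable (\<lambda>k. real (Suc k) ^ n * \<bar>\<mu>\<bar> ^ k)"
  proof (rule summable_ratio_test[OF c(2), of K])
    fix k assume "K \<le> k"
    have "real (Suc (Suc k)) = real (Suc k) * (1 + 1 / real (Suc k))"
      by (simp add: field_simps)
    then have "real (Suc (Suc k)) ^ n * \<bar>\<mu>\<bar> ^ Suc k
        = ((1 + 1 / real (Suc k)) ^ n * \<bar>\<mu>\<bar>) * (real (Suc k) ^ n * \<bar>\<mu>\<bar> ^ k)"
      by (simp only: power_mult_distrib power_Suc mult_ac)
    also have "\<dots> \<le> c * (real (Suc k) ^ n * \<bar>\<mu>\<bar> ^ k)"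
      using K[OF \<open>K \<le> k\<close>] by (intro mult_right_mono) auto
    finally show "norm (real (Suc (Suc k)) ^ n * \<bar>\<mu>\<bar> ^ Suc k)
        \<le> c * norm (real (Suc k) ^ n * \<bar>\<mu>\<bar> ^ k)"
      by (simp add: abs_mult)
  qed
  show ?thesis
  proof (rule summable_comparison_test'[OF sum, of 0])
    fix k
    have "neg_binomial_fps (\<alpha> * real k + 1) $ n = (\<Prod>i<n. (\<alpha> * real k + 1 + real i) / (1 + real i))"
      by (simp add: neg_binomial_fps_nth pochhammer_prod fact_prod_Suc prod_dividef atLeast0LessThan)
    \<comment> \<open>Factor by factor, \<alpha> k + 1 + i is at most (k + 1)(1 + i) since \<alpha>
      is at most 1.\<close>
    also have "\<dots> \<le> (\<Prod>i<n. real (Suc k))"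
    proof (intro prod_mono conjI)
      fix i
      have "\<alpha> * real k \<le> 1 * real k" using assms by (intro mult_right_mono) auto
      then have "\<alpha> * real k \<le> real k + real k * real i" by (simp add: add_increasing2)
      then show "(\<alpha> * real k + 1 + real i) / (1 + real i) \<le> real (Suc k)"
        by (simp add: field_simps)
    qed (use assms in auto)
    finally have "neg_binomial_fps (\<alpha> * real k + 1) $ n \<le> real (Suc k) ^ n" by simp
    then show "norm (\<mu> ^ k * neg_binomial_fps (\<alpha> * real k + 1) $ n) \<le> real (Suc k) ^ n * \<bar>\<mu>\<bar> ^ k"
      using assms by (simp add: abs_mult power_abs neg_binomial_fps_nth_nonneg mult_ac mult_left_mono)
  qed
qed

text \<open>The discretisation of the fractional relaxation equation \<open>D\<^sup>\<alpha> u = - \<lambda> u\<close> with step \<open>h\<close>, where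
  \<open>\<mu> = \<lambda> h\<^sup>\<alpha>\<close>; the Neumann series of \<open>(1 - X)\<^sup>-\<^sup>1 / (1 + \<mu> (1 - X)\<^sup>-\<^sup>\<alpha>)\<close>.\<close>

definition discrete_relaxation :: "real \<Rightarrow> real \<Rightarrow> real fps" where
  "discrete_relaxation \<alpha> \<mu> =
     Abs_fps (\<lambda>n. \<Sum>k. (- \<mu>) ^ k * neg_binomial_fps (\<alpha> * real k + 1) $ n)"

text \<open>Multiplying the series by \<mu> (1 - X)^(-\<alpha>) shifts its index by one and flips
  the sign, so adding the result to the series leaves only the term k = 0, which is (1 - X)^(-1).
  Multiplication by (1 - X)^\<alpha> then gives the claim.\<close>

lemma discrete_relaxation_mult:
  assumes "0 \<le> \<alpha>" "\<alpha> \<le> 1" "\<bar>\<mu>\<bar> < 1"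
  shows "discrete_relaxation \<alpha> \<mu> * (neg_binomial_fps (- \<alpha>) + fps_const \<mu>) = neg_binomial_fps (1 - \<alpha>)"
proof -
  let ?N = neg_binomial_fps and ?U = "discrete_relaxation \<alpha> \<mu>"
  let ?t = "\<lambda>n k. (- \<mu>) ^ k * ?N (\<alpha> * real k + 1) $ n"
  have summable: "summable (?t n)" for n
    using summable_neg_binomial_fps_nth[of \<alpha> "- \<mu>"] assms by simp
  have "?U + fps_const \<mu> * (?U * ?N \<alpha>) = ?N 1"
  proof (rule fps_ext)
    fix n
    have "(?U * ?N \<alpha>) $ n = (\<Sum>i\<le>n. (\<Sum>k. ?t i k * ?N \<alpha> $ (n - i)))"
      by (simp add: fps_mult_nth discrete_relaxation_def suminf_mult2[OF summable] atLeast0AtMost)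
    also have "\<dots> = (\<Sum>k. \<Sum>i\<le>n. ?t i k * ?N \<alpha> $ (n - i))"
      by (intro suminf_sum[symmetric] summable_mult2 summable)
    also have "(\<lambda>k. \<Sum>i\<le>n. ?t i k * ?N \<alpha> $ (n - i))
        = (\<lambda>k. (- \<mu>) ^ k * (?N (\<alpha> * real k + 1) * ?N \<alpha>) $ n)"
      by (simp add: fun_eq_iff fps_mult_nth sum_distrib_left atLeast0AtMost mult.assoc)
    also have "\<dots> = (\<lambda>k. (- \<mu>) ^ k * ?N (\<alpha> * real (Suc k) + 1) $ n)"
      by (simp add: neg_binomial_fps_add[symmetric] algebra_simps)
    finally have "(fps_const \<mu> * (?U * ?N \<alpha>)) $ n
        = \<mu> * (\<Sum>k. (- \<mu>) ^ k * ?N (\<alpha> * real (Suc k) + 1) $ n)" by simp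
    also have "\<dots> = - (\<Sum>k. ?t n (Suc k))"
    proof (cases "\<mu> = 0")
      case False
      \<comment> \<open>Summability of the shifted series comes from dividing the tail of the
        original one by - \<mu>, hence the separate case \<mu> = 0.\<close>
      have "summable (\<lambda>k. (- 1 / \<mu>) * ?t n (Suc k))"
        by (intro summable_mult summable_Suc_iff[THEN iffD2, OF summable[of n]])
      then have "summable (\<lambda>k. (- \<mu>) ^ k * ?N (\<alpha> * real (Suc k) + 1) $ n)"
        using False by (simp add: mult.assoc)
      then have "- \<mu> * (\<Sum>k. (- \<mu>) ^ k * ?N (\<alpha> * real (Suc k) + 1) $ n) = (\<Sum>k. ?t n (Suc k))"
        by (subst suminf_mult[symmetric]) (auto simp: mult.assoc)
      then show ?thesis by simp
    qed simp
    also have "(\<Sum>k. ?t n (Suc k)) = ?U $ n - ?N 1 $ n"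
      using suminf_split_head[OF summable[of n]] by (simp add: discrete_relaxation_def)
    finally show "(?U + fps_const \<mu> * (?U * ?N \<alpha>)) $ n = ?N 1 $ n" by simp
  qed
  then have "(?U + fps_const \<mu> * (?U * ?N \<alpha>)) * ?N (- \<alpha>) = ?N (1 - \<alpha>)"
    by (simp add: neg_binomial_fps_add[symmetric])
  moreover have "(?U + fps_const \<mu> * (?U * ?N \<alpha>)) * ?N (- \<alpha>)
      = ?U * ?N (- \<alpha>) + ?U * fps_const \<mu> * (?N \<alpha> * ?N (- \<alpha>))"
    unfolding distrib_right by (simp only: mult_ac)
  moreover have "?N \<alpha> * ?N (- \<alpha>) = 1"
    by (simp add: neg_binomial_fps_add[symmetric] neg_binomial_fps_0)
  ultimately show ?thesis
    by (simp add: distrib_left)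
qed

lemma fps_nth_nonneg_if_mult_resolvent_nonneg:
  assumes "0 \<le> \<alpha>" "\<alpha> \<le> 1" "0 \<le> \<mu>"
    and "\<And>n. 0 \<le> (G * (neg_binomial_fps (- \<alpha>) + fps_const \<mu>)) $ n"
  shows "0 \<le> G $ n"
proof (rule fps_nth_nonneg_if_mult_nonneg[OF _ _ assms(4)])
  show "(neg_binomial_fps (- \<alpha>) + fps_const \<mu>) $ 0 > 0"
    using assms by (simp add: neg_binomial_fps_nth)
  show "(neg_binomial_fps (- \<alpha>) + fps_const \<mu>) $ n \<le> 0" if "n > 0" for n
    using neg_binomial_fps_minus_nth_nonpos[OF assms(1,2) that] that by simp
qed

lemma discrete_relaxation_nonneg:
  assumes "0 \<le> \<alpha>" "\<alpha> \<le> 1" "0 \<le> \<mu>" "\<mu> < 1"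
  shows "0 \<le> discrete_relaxation \<alpha> \<mu> $ n"
  by (rule fps_nth_nonneg_if_mult_resolvent_nonneg[OF assms(1-3)])
     (use assms in \<open>simp add: discrete_relaxation_mult neg_binomial_fps_nth_nonneg\<close>)

text \<open>A resolvent identity: both series solve an equation with the same right-hand side, so
  (U(\<mu>) - U(\<nu>)) P(\<mu>) = (\<nu> - \<mu>) U(\<nu>), whose coefficients are
  nonnegative.\<close>

lemma discrete_relaxation_antimono:
  assumes "0 \<le> \<alpha>" "\<alpha> \<le> 1" "0 \<le> \<mu>" "\<mu> \<le> \<nu>" "\<nu> < 1"
  shows "discrete_relaxation \<alpha> \<nu> $ n \<le> discrete_relaxation \<alpha> \<mu> $ n"
proof -
  let ?U = "discrete_relaxation \<alpha>" and ?P = "\<lambda>\<mu>. neg_binomial_fps (- \<alpha>) + fps_const \<mu>"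
  have "?U \<mu> * ?P \<mu> = ?U \<nu> * ?P \<nu>"
    using assms by (simp add: discrete_relaxation_mult)
  then have "(?U \<mu> - ?U \<nu>) * ?P \<mu> = ?U \<nu> * (?P \<nu> - ?P \<mu>)"
    by (simp only: left_diff_distrib right_diff_distrib)
  also have "?P \<nu> - ?P \<mu> = fps_const (\<nu> - \<mu>)" by simp
  finally have eq: "(?U \<mu> - ?U \<nu>) * ?P \<mu> = ?U \<nu> * fps_const (\<nu> - \<mu>)" .
  have "0 \<le> ((?U \<mu> - ?U \<nu>) * ?P \<mu>) $ m" for m
    unfolding eq using assms by (simp add: discrete_relaxation_nonneg)
  from fps_nth_nonneg_if_mult_resolvent_nonneg[OF assms(1-3) this] show ?thesis by simp
qed

section \<open>Passage to the limit\<close>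

text \<open>The product limit for 1/Gamma. The library's \<open>rGamma_series\<close> carries one
  more factor s + 1 + n and one more power of n, hence the division by 1 + (s + 1)/n.\<close>

lemma neg_binomial_fps_nth_asymp:
  assumes "s \<ge> 0"
  shows "(\<lambda>n. neg_binomial_fps (s + 1) $ n / real n powr s) \<longlonglongrightarrow> 1 / Gamma (s + 1)"
proof -
  have "(\<lambda>n. rGamma_series (s + 1) n / (1 + (s + 1) * (1 / real n)))
      \<longlonglongrightarrow> rGamma (s + 1) / (1 + (s + 1) * 0)"
    by (intro tendsto_intros lim_1_over_n) auto
  moreover have "eventually (\<lambda>n. rGamma_series (s + 1) n / (1 + (s + 1) * (1 / real n))
      = neg_binomial_fps (s + 1) $ n / real n powr s) sequentially"
    using eventually_gt_at_top[of 0]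
  proof eventually_elim
    case (elim n)
    have *: "exp ((s + 1) * ln (real n)) = real n powr s * real n"
      using elim by (simp add: powr_def exp_add algebra_simps)
    have "s + 1 + real n > 0" using assms by simp
    then show ?case
      using elim by (simp add: rGamma_series_def * neg_binomial_fps_nth pochhammer_Suc divide_simps)
  qed
  ultimately have "(\<lambda>n. neg_binomial_fps (s + 1) $ n / real n powr s) \<longlonglongrightarrow> rGamma (s + 1)"
    using Lim_transform_eventually by fastforce
  then show ?thesis by (simp add: rGamma_inverse_Gamma inverse_eq_divide)
qed

text \<open>Provides the majorant for Tannery's theorem. The quotient of consecutive terms is (1 +
  s/(n + 1)) (n/(n + 1))^s, which is at most 1 because 1 + y <= exp y and ln ((n + 1)/n) >= 1/(n +
  1).\<close>

lemma neg_binomial_fps_nth_decreasing: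
  assumes "s \<ge> 0" "0 < m" "m \<le> n"
  shows "neg_binomial_fps (s + 1) $ n / real n powr s \<le> neg_binomial_fps (s + 1) $ m / real m powr s"
  using assms(3)
proof (induction n rule: dec_induct)
  case (step n)
  then have n: "n > 0" using assms by simp
  have "1 - 1 / (1 + real n) = real n / (1 + real n)" by (simp add: field_simps)
  then have "ln (real n / (1 + real n)) \<le> - 1 / (1 + real n)"
    using ln_le_minus_one[of "real n / (1 + real n)"] n by simp
  then have "1 / (1 + real n) \<le> ln ((1 + real n) / real n)"
    using n by (simp add: ln_div)
  then have "s * (1 / (1 + real n)) \<le> s * ln ((1 + real n) / real n)"
    using assms by (intro mult_left_mono) auto
  then have "1 + s / (1 + real n) \<le> exp (s * ln ((1 + real n) / real n))"
    using order_trans[OF _ exp_ge_add_one_self] by auto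
  also have "\<dots> = (1 + real n) powr s / real n powr s"
    using n by (simp add: powr_def ln_div exp_diff right_diff_distrib)
  finally have "(1 + s / (1 + real n)) / (1 + real n) powr s
      \<le> (1 + real n) powr s / real n powr s / (1 + real n) powr s"
    by (rule divide_right_mono) simp
  also have "\<dots> = 1 / real n powr s"
    using n by simp
  finally have le: "(1 + s / (1 + real n)) / (1 + real n) powr s \<le> 1 / real n powr s" .
  have "neg_binomial_fps (s + 1) $ Suc n = neg_binomial_fps (s + 1) $ n * (1 + s / (1 + real n))"
    by (simp add: neg_binomial_fps_nth pochhammer_Suc field_simps)
  then have "neg_binomial_fps (s + 1) $ Suc n / real (Suc n) powr s
      = neg_binomial_fps (s + 1) $ n * ((1 + s / (1 + real n)) / (1 + real n) powr s)"
    by simp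
  also have "\<dots> \<le> neg_binomial_fps (s + 1) $ n * (1 / real n powr s)"
    using assms le by (intro mult_left_mono neg_binomial_fps_nth_nonneg) auto
  finally show ?case using step.IH by simp
qed simp

text \<open>The powers of n in \<mu>^k cancel the growth of the k-th coefficient, so each term
  converges to the corresponding term of the Mittag-Leffler series. As the normalised coefficients
  decrease in n, the terms at one fixed \<open>N\<close> with x/N^\<alpha> < 1 dominate all later
  ones. The second claim gives the range of \<mu> in which sign and monotonicity are known.\<close>

lemma discrete_relaxation_tendsto_mittag_leffler:
  assumes "0 < \<alpha>" "\<alpha> \<le> 1" "0 \<le> x"
  shows "(\<lambda>n. discrete_relaxation \<alpha> (x / real n powr \<alpha>) $ n) \<longlonglongrightarrow> mittag_leffler \<alpha> (- x)"
    and "eventually (\<lambda>n. x / real n powr \<alpha> < 1) sequentially"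
proof -
  have "(\<lambda>n. x * real n powr (- \<alpha>)) \<longlonglongrightarrow> x * 0"
    using assms by (intro tendsto_intros tendsto_neg_powr filterlim_real_sequentially) auto
  then have "(\<lambda>n. x / real n powr \<alpha>) \<longlonglongrightarrow> 0"
    by (simp add: powr_minus_divide)
  then show ev: "eventually (\<lambda>n. x / real n powr \<alpha> < 1) sequentially"
    by (rule order_tendstoD) simp
  from eventually_conj[OF this eventually_gt_at_top[of 0]]
  obtain N where N: "x / real N powr \<alpha> < 1" "N > 0"
    using eventually_happens' sequentially_bot by blast
  let ?c = "\<lambda>k n. neg_binomial_fps (\<alpha> * real k + 1) $ n / real n powr (\<alpha> * real k)"
  \<comment> \<open>This fails for n = k = 0: there \<open>0 powr 0 = 0\<close> and division by zero
    make the right-hand side 0, while the left-hand side is 1.\<close>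
  have eq: "(\<kappa> / real n powr \<alpha>) ^ k * neg_binomial_fps (\<alpha> * real k + 1) $ n = \<kappa> ^ k * ?c k n"
    if "n > 0" for \<kappa> k n
    using that by (simp add: power_divide powr_powr[symmetric] powr_realpow)
  have "(\<lambda>n. \<Sum>k. (- x) ^ k * ?c k n) \<longlonglongrightarrow> (\<Sum>k. (- x) ^ k * (1 / Gamma (\<alpha> * real k + 1)))"
  proof (rule tannerys_theorem[THEN conjunct2, THEN conjunct2])
    show "(\<lambda>n. (- x) ^ k * ?c k n) \<longlonglongrightarrow> (- x) ^ k * (1 / Gamma (\<alpha> * real k + 1))" for k
      using assms by (intro tendsto_mult tendsto_const neg_binomial_fps_nth_asymp) auto
    show "summable (\<lambda>k. x ^ k * ?c k N)"
      using summable_neg_binomial_fps_nth[of \<alpha> "x / real N powr \<alpha>" N] assms N by (simp add: eq[OF N(2)])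
    have "norm ((- x) ^ k * ?c k n) \<le> x ^ k * ?c k N" if "n \<ge> N" for k n
    proof -
      have "?c k n \<ge> 0" using assms by (simp add: neg_binomial_fps_nth_nonneg)
      moreover have "?c k n \<le> ?c k N"
        using assms N that by (intro neg_binomial_fps_nth_decreasing) auto
      ultimately have "x ^ k * \<bar>?c k n\<bar> \<le> x ^ k * ?c k N"
        using assms by (intro mult_left_mono) auto
      then show ?thesis
        using assms by (simp only: real_norm_def abs_mult power_abs abs_minus abs_of_nonneg)
    qed
    then show "eventually (\<lambda>(k, n). norm ((- x) ^ k * ?c k n) \<le> x ^ k * ?c k N) (at_top \<times>\<^sub>F sequentially)"
      by (subst eventually_prod_sequentially) auto
  qed simp
  moreover have "eventually (\<lambda>n. (\<Sum>k. (- x) ^ k * ?c k n)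
      = discrete_relaxation \<alpha> (x / real n powr \<alpha>) $ n) sequentially"
    using eventually_gt_at_top[of 0]
  proof eventually_elim
    case (elim n)
    show ?case
      using eq[OF elim, of "- x"] by (simp add: discrete_relaxation_def)
  qed
  ultimately show "(\<lambda>n. discrete_relaxation \<alpha> (x / real n powr \<alpha>) $ n) \<longlonglongrightarrow> mittag_leffler \<alpha> (- x)"
    unfolding mittag_leffler_def using Lim_transform_eventually by fastforce
qed

lemma mittag_leffler_minus_nonneg:
  assumes "0 < \<alpha>" "\<alpha> \<le> 1" "0 \<le> x"
  shows "0 \<le> mittag_leffler \<alpha> (- x)"
proof (rule tendsto_lowerbound[OF discrete_relaxation_tendsto_mittag_leffler(1)[OF assms]])
  show "eventually (\<lambda>n. 0 \<le> discrete_relaxation \<alpha> (x / real n powr \<alpha>) $ n) sequentially"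
    using discrete_relaxation_tendsto_mittag_leffler(2)[OF assms]
    by eventually_elim (use assms in \<open>simp add: discrete_relaxation_nonneg\<close>)
qed simp

lemma mittag_leffler_minus_antimono:
  assumes "0 < \<alpha>" "\<alpha> \<le> 1" "0 \<le> x" "x \<le> y"
  shows "mittag_leffler \<alpha> (- y) \<le> mittag_leffler \<alpha> (- x)"
proof (rule tendsto_le[OF sequentially_bot])
  show "(\<lambda>n. discrete_relaxation \<alpha> (x / real n powr \<alpha>) $ n) \<longlonglongrightarrow> mittag_leffler \<alpha> (- x)"
    "(\<lambda>n. discrete_relaxation \<alpha> (y / real n powr \<alpha>) $ n) \<longlonglongrightarrow> mittag_leffler \<alpha> (- y)"
    using assms by (auto intro: discrete_relaxation_tendsto_mittag_leffler(1))
  have "eventually (\<lambda>n. y / real n powr \<alpha> < 1) sequentially"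
    using assms by (intro discrete_relaxation_tendsto_mittag_leffler(2)) auto
  then show "eventually (\<lambda>n. discrete_relaxation \<alpha> (y / real n powr \<alpha>) $ n
      \<le> discrete_relaxation \<alpha> (x / real n powr \<alpha>) $ n) sequentially"
    by eventually_elim
      (use assms in \<open>auto intro!: discrete_relaxation_antimono divide_right_mono\<close>)
qed

section \<open>Smooth step functions\<close>

text \<open>The classical flat function exp(-1/x), extended by 0, together with its quotients by
  powers of x: a family whose derivatives are linear combinations of its own members.\<close>

definition flat_fun :: "nat \<Rightarrow> real \<Rightarrow> real" where
  "flat_fun k x = (if x \<le> 0 then 0 else exp (- 1 / x) / x ^ k)"

text \<open>From the right, substitute y = 1/x and use that exp y outgrows y^k.\<close>

lemma flat_fun_tendsto_0: "(flat_fun k \<longlongrightarrow> 0) (at 0)"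
proof -
  have "((\<lambda>x. inverse x ^ k / exp (inverse x)) \<longlongrightarrow> 0) (at_right (0::real))"
    by (rule filterlim_compose[OF tendsto_power_div_exp_0 filterlim_inverse_at_top_right])
  moreover have "eventually (\<lambda>x. inverse x ^ k / exp (inverse x) = flat_fun k x) (at_right 0)"
    using eventually_at_right_less[of "0::real"]
    by eventually_elim (simp add: flat_fun_def exp_minus divide_simps)
  ultimately have "(flat_fun k \<longlongrightarrow> 0) (at_right 0)"
    by (rule Lim_transform_eventually)
  moreover have "eventually (\<lambda>x. 0 = flat_fun k x) (at_left 0)"
    by (auto simp: flat_fun_def eventually_at_filter)
  then have "(flat_fun k \<longlongrightarrow> 0) (at_left 0)"
    by (rule Lim_transform_eventually[OF tendsto_const])
  ultimately show ?thesis
    by (simp add: filterlim_at_split)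
qed

lemma flat_fun_has_derivative:
  "(flat_fun k has_real_derivative flat_fun (k + 2) x - real k * flat_fun (k + 1) x) (at x)"
proof -
  consider "x < 0" | "x = 0" | "x > 0" by linarith
  then show ?thesis
  proof cases
    case 1
    have "((\<lambda>_. 0) has_real_derivative 0) (at x)" by simp
    then have "(flat_fun k has_real_derivative 0) (at x)"
      by (rule has_field_derivative_transform_within_open[where S = "{..<0}"])
         (use 1 in \<open>auto simp: flat_fun_def\<close>)
    then show ?thesis using 1 by (simp add: flat_fun_def)
  next
    case 2
    \<comment> \<open>The difference quotient of \<open>flat_fun k\<close> at 0 is
      \<open>flat_fun (Suc k)\<close> itself.\<close>
    have "((\<lambda>h. flat_fun (Suc k) h) \<longlongrightarrow> 0) (at 0)" by (rule flat_fun_tendsto_0)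
    moreover have "eventually (\<lambda>h. flat_fun (Suc k) h = (flat_fun k (0 + h) - flat_fun k 0) / h) (at 0)"
      by (auto simp: flat_fun_def eventually_at_filter)
    ultimately have "((\<lambda>h. (flat_fun k (0 + h) - flat_fun k 0) / h) \<longlongrightarrow> 0) (at 0)"
      by (rule Lim_transform_eventually)
    then show ?thesis using 2 by (simp add: DERIV_def flat_fun_def)
  next
    case 3
    have "((\<lambda>x. exp (- 1 / x) / x ^ k) has_real_derivative
        (exp (- 1 / x) * (1 / x\<^sup>2) * x ^ k - exp (- 1 / x) * (real k * x ^ (k - 1)))
          / (x ^ k * x ^ k)) (at x)"
      using 3 by (auto intro!: derivative_eq_intros simp: power2_eq_square)
    also have "real k * x ^ (k - 1) = real k * x ^ k / x"
      using 3 by (cases k) auto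
    also have "(exp (- 1 / x) * (1 / x\<^sup>2) * x ^ k - exp (- 1 / x) * (real k * x ^ k / x))
          / (x ^ k * x ^ k) = flat_fun (k + 2) x - real k * flat_fun (k + 1) x"
      using 3 by (simp add: flat_fun_def power_add power2_eq_square divide_simps) (simp add: algebra_simps)
    finally have "((\<lambda>x. exp (- 1 / x) / x ^ k) has_real_derivative
        flat_fun (k + 2) x - real k * flat_fun (k + 1) x) (at x)" .
    then show ?thesis
      by (rule has_field_derivative_transform_within_open[where S = "{0<..}"])
         (use 3 in \<open>auto simp: flat_fun_def\<close>)
  qed
qed

text \<open>Not all smooth functions, only a class closed under differentiation and rich enough for step
  functions.\<close>

inductive smooth_fun :: "(real \<Rightarrow> real) \<Rightarrow> bool" where
  smooth_fun_const: "smooth_fun (\<lambda>x. c)"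
| smooth_fun_flat: "smooth_fun (flat_fun k)"
| smooth_fun_affine: "smooth_fun f \<Longrightarrow> smooth_fun (\<lambda>x. f (c * x + d))"
| smooth_fun_add: "smooth_fun f \<Longrightarrow> smooth_fun g \<Longrightarrow> smooth_fun (\<lambda>x. f x + g x)"
| smooth_fun_mult: "smooth_fun f \<Longrightarrow> smooth_fun g \<Longrightarrow> smooth_fun (\<lambda>x. f x * g x)"
| smooth_fun_inverse: "smooth_fun f \<Longrightarrow> (\<And>x. f x \<noteq> 0) \<Longrightarrow> smooth_fun (\<lambda>x. inverse (f x))"

lemma smooth_fun_diff: "smooth_fun f \<Longrightarrow> smooth_fun g \<Longrightarrow> smooth_fun (\<lambda>x. f x - g x)"
  using smooth_fun_add[OF _ smooth_fun_mult[OF smooth_fun_const[of "- 1"]]] by simp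

lemma smooth_fun_has_smooth_derivative:
  assumes "smooth_fun f"
  shows "\<exists>f'. smooth_fun f' \<and> (\<forall>x. (f has_real_derivative f' x) (at x))"
  using assms
proof induction
  case (smooth_fun_const c)
  then show ?case
    by (intro exI[of _ "\<lambda>_. 0"]) (simp add: smooth_fun.smooth_fun_const)
next
  case (smooth_fun_flat k)
  then show ?case
    by (intro exI[of _ "\<lambda>x. flat_fun (k + 2) x - real k * flat_fun (k + 1) x"])
       (intro conjI allI flat_fun_has_derivative smooth_fun_diff smooth_fun.smooth_fun_flat
         smooth_fun.smooth_fun_const smooth_fun_mult)
next
  case (smooth_fun_affine f c d)
  then obtain f' where f': "smooth_fun f'" "\<And>x. (f has_real_derivative f' x) (at x)" by blast
  have "((\<lambda>x. f (c * x + d)) has_real_derivative f' (c * x + d) * c) (at x)" for x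
    by (rule DERIV_chain2[OF f'(2)]) (auto intro!: derivative_eq_intros)
  with f' show ?case
    by (intro exI[of _ "\<lambda>x. f' (c * x + d) * c"])
       (simp add: smooth_fun.smooth_fun_affine smooth_fun_mult smooth_fun.smooth_fun_const)
next
  case (smooth_fun_add f g)
  then obtain f' g' where "smooth_fun f'" "\<And>x. (f has_real_derivative f' x) (at x)"
    "smooth_fun g'" "\<And>x. (g has_real_derivative g' x) (at x)" by blast
  then show ?case
    by (intro exI[of _ "\<lambda>x. f' x + g' x"])
       (auto intro!: smooth_fun.smooth_fun_add derivative_eq_intros)
next
  case (smooth_fun_mult f g)
  then obtain f' g' where "smooth_fun f'" "\<And>x. (f has_real_derivative f' x) (at x)"
    "smooth_fun g'" "\<And>x. (g has_real_derivative g' x) (at x)" by blast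
  then show ?case
    using smooth_fun_mult.hyps
    by (intro exI[of _ "\<lambda>x. f' x * g x + g' x * f x"] conjI)
       (auto intro!: smooth_fun.smooth_fun_add smooth_fun.smooth_fun_mult derivative_eq_intros)
next
  case (smooth_fun_inverse f)
  then obtain f' where f': "smooth_fun f'" "\<And>x. (f has_real_derivative f' x) (at x)" by blast
  have "smooth_fun (\<lambda>x. - 1 * (inverse (f x) * f' x * inverse (f x)))"
    using f'(1) smooth_fun_inverse.hyps
    by (intro smooth_fun_mult smooth_fun_const smooth_fun.smooth_fun_inverse) auto
  with f'(2) smooth_fun_inverse.hyps(2) show ?case
    by (intro exI[of _ "\<lambda>x. - 1 * (inverse (f x) * f' x * inverse (f x))"])
       (auto intro!: derivative_eq_intros)
qed

lemma smooth_fun_higher_deriv: "smooth_fun f \<Longrightarrow> smooth_fun ((deriv ^^ n) f)"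
proof (induction n)
  case (Suc n)
  then obtain g where g: "smooth_fun g" "\<And>x. ((deriv ^^ n) f has_real_derivative g x) (at x)"
    using smooth_fun_has_smooth_derivative by blast
  then have "deriv ((deriv ^^ n) f) = g" by (auto simp: DERIV_imp_deriv)
  then show ?case using g by simp
qed simp

lemma smooth_fun_differentiable: "smooth_fun f \<Longrightarrow> f differentiable (at x)"
  using smooth_fun_has_smooth_derivative by (meson real_differentiable_def)

lemma smooth_fun_continuous_on: "smooth_fun f \<Longrightarrow> continuous_on A f"
  by (simp add: smooth_fun_differentiable differentiable_imp_continuous_on
      differentiable_at_imp_differentiable_on)

lemma smooth_step_exists:
  obtains S where "smooth_fun S" "\<And>x. x \<le> 0 \<Longrightarrow> S x = 0" "\<And>x. 1 \<le> x \<Longrightarrow> S x = 1"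
    "\<And>x. 0 \<le> S x" "\<And>x. S x \<le> 1"
proof
  \<comment> \<open>With e = \<open>flat_fun 0\<close> this is e(x) / (e(x) + e(1 - x)). The
    denominator is positive since x or 1 - x is; 1 - x is written so as to fit the affine rule of
    \<open>smooth_fun\<close>.\<close>
  define S where "S = (\<lambda>x. flat_fun 0 x * inverse (flat_fun 0 x + flat_fun 0 (- 1 * x + 1)))"
  have nonneg: "flat_fun 0 x \<ge> 0" and pos: "x > 0 \<Longrightarrow> flat_fun 0 x > 0"
    and zero: "x \<le> 0 \<Longrightarrow> flat_fun 0 x = 0" for x
    by (auto simp: flat_fun_def)
  have sum_pos: "flat_fun 0 x + flat_fun 0 (- 1 * x + 1) > 0" for x
    using pos[of x] pos[of "- 1 * x + 1"] nonneg[of x] nonneg[of "- 1 * x + 1"]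
    by (cases "x > 0") (auto intro: add_pos_nonneg add_nonneg_pos)
  show "smooth_fun S"
    unfolding S_def using sum_pos
    by (intro smooth_fun_mult smooth_fun_inverse smooth_fun_add smooth_fun_flat smooth_fun_affine)
       (metis less_irrefl)
  show "S x = 0" if "x \<le> 0" for x using that by (simp add: S_def zero)
  show "S x = 1" if "1 \<le> x" for x using that pos[of x] by (simp add: S_def zero)
  show "0 \<le> S x" for x using sum_pos[of x] nonneg by (simp add: S_def)
  show "S x \<le> 1" for x
    using sum_pos[of x] nonneg[of "- 1 * x + 1"] unfolding S_def divide_inverse[symmetric]
    by (subst divide_le_eq_1_pos) auto
qed

section \<open>The fundamental theorem of calculus for weak derivatives\<close>

text \<open>The interval has finite measure and |y| <= 1 + y^2.\<close>

lemma L2_on_set_integrable: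
  assumes "L2_on a b f"
  shows "set_integrable lborel {a<..<b} f"
proof -
  have "set_integrable lborel {a<..<b} (\<lambda>_. 1::real)"
    by (rule set_integrable_subset[OF borel_integrable_atLeastAtMost'[of a b]]) auto
  then have "set_integrable lborel {a<..<b} (\<lambda>x. 1 + (f x)\<^sup>2)"
    using assms
    unfolding L2_on_def by (intro set_integral_add) auto
  then show ?thesis
  proof (rule set_integrable_bound)
    show "set_borel_measurable lborel {a<..<b} f" using assms by (simp add: L2_on_def)
    have "\<bar>y\<bar> \<le> 1 + y\<^sup>2" for y :: real
      using zero_le_power2[of "\<bar>y\<bar> - 1"] by (simp add: power2_diff)
    then show "AE x in lborel. x \<in> {a<..<b} \<longrightarrow> norm (f x) \<le> norm (1 + (f x)\<^sup>2)"
      by (auto intro: order_trans)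
  qed
qed

text \<open>The substitution x = c + y/n turns the integrand into F(c + y/n) h(y), which converges
  pointwise by continuity at \<open>c\<close> and is dominated by M |h|.\<close>

lemma integral_approximate_identity:
  fixes F h :: "real \<Rightarrow> real"
  assumes [measurable]: "F \<in> borel_measurable borel" and bound: "\<And>x. \<bar>F x\<bar> \<le> M"
    and "isCont F c" and h: "integrable lborel h"
  shows "(\<lambda>n. \<integral>x. F x * (real n * h (real n * (x - c))) \<partial>lborel) \<longlonglongrightarrow> F c * (\<integral>y. h y \<partial>lborel)"
    and "integrable lborel (\<lambda>x. F x * (real n * h (real n * (x - c))))"
proof -
  have [measurable]: "h \<in> borel_measurable borel" using h by auto
  have "(\<lambda>n. \<integral>y. F (c + y / real n) * h y \<partial>lborel) \<longlonglongrightarrow> (\<integral>y. F c * h y \<partial>lborel)"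
  proof (rule integral_dominated_convergence)
    show "integrable lborel (\<lambda>y. M * \<bar>h y\<bar>)" using h by simp
    show "AE y in lborel. (\<lambda>n. F (c + y / real n) * h y) \<longlonglongrightarrow> F c * h y"
    proof (intro AE_I2 tendsto_intros)
      fix y
      have "(\<lambda>n. c + y / real n) \<longlonglongrightarrow> c + 0"
        by (intro tendsto_intros lim_const_over_n)
      then show "(\<lambda>n. F (c + y / real n)) \<longlonglongrightarrow> F c"
        using isCont_tendsto_compose[OF \<open>isCont F c\<close>] by simp
    qed
    show "AE y in lborel. norm (F (c + y / real n) * h y) \<le> M * \<bar>h y\<bar>" for n
      using bound by (auto simp: abs_mult intro!: mult_right_mono)
  qed auto
  moreover have "eventually (\<lambda>n. (\<integral>y. F (c + y / real n) * h y \<partial>lborel)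
      = (\<integral>x. F x * (real n * h (real n * (x - c))) \<partial>lborel)) sequentially"
    using eventually_gt_at_top[of 0]
  proof eventually_elim
    case (elim n)
    then show ?case
      using lborel_integral_real_affine[of "1 / real n" "\<lambda>x. F x * (real n * h (real n * (x - c)))" c]
      by (simp add: mult_ac)
  qed
  ultimately show "(\<lambda>n. \<integral>x. F x * (real n * h (real n * (x - c))) \<partial>lborel)
      \<longlonglongrightarrow> F c * (\<integral>y. h y \<partial>lborel)"
    using Lim_transform_eventually by fastforce
  show "integrable lborel (\<lambda>x. F x * (real n * h (real n * (x - c))))"
  proof (cases "n = 0")
    case False
    then have "integrable lborel (\<lambda>x. M * (real n * \<bar>h (- real n * c + real n * x)\<bar>))"
      using lborel_integrable_real_affine[OF h, of "real n" "- real n * c"] by simp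
    then show ?thesis
    proof (rule Bochner_Integration.integrable_bound)
      have "\<bar>F x\<bar> \<le> \<bar>M\<bar>" for x
        using order_trans[OF bound abs_ge_self] .
      then show "AE x in lborel. norm (F x * (real n * h (real n * (x - c))))
          \<le> norm (M * (real n * \<bar>h (- real n * c + real n * x)\<bar>))"
        by (intro AE_I2) (auto simp: abs_mult right_diff_distrib intro!: mult_right_mono)
    qed simp
  qed simp
qed

text \<open>Both sides of the weak derivative identity are passed to the limit along the test
  functions \<open>\<phi> n\<close>: the left by the approximate identity with kernel S', the right
  by dominated convergence.\<close>

lemma weak_deriv_integral_open:
  assumes weak: "has_weak_deriv_L2 a b f g" and cont: "continuous_on {a..b} f"
    and pq: "a < p" "p < q" "q < b"
  shows "f q - f p = (LBINT x:{p<..q}. indicator {a<..<b} x * g x)"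
proof -
  obtain S where S: "smooth_fun S" and S0: "\<And>x. x \<le> 0 \<Longrightarrow> S x = 0" and S1: "\<And>x. 1 \<le> x \<Longrightarrow> S x = 1"
    and S_nonneg: "\<And>x. 0 \<le> S x" and S_le: "\<And>x. S x \<le> 1"
    using smooth_step_exists by blast
  obtain h where h: "smooth_fun h" "\<And>x. (S has_real_derivative h x) (at x)"
    using smooth_fun_has_smooth_derivative[OF S] by blast
  \<comment> \<open>\<open>S\<close> is locally constant off [0, 1], so \<open>h\<close> lives on
    [0, 1] and has total integral S 1 - S 0 = 1.\<close>
  have h0: "h x = 0" if "x \<notin> {0..1}" for x
  proof -
    have "((\<lambda>_. S x) has_real_derivative 0) (at x)" by simp
    then have "(S has_real_derivative 0) (at x)"
      by (rule has_field_derivative_transform_within_open[where S = "if x < 0 then {..<0} else {1<..}"])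
         (use that S0 S1 in \<open>auto split: if_splits\<close>)
    then show ?thesis using h(2) DERIV_unique by blast
  qed
  then have h_ind: "h x * indicator {0..1} x = h x" for x
    by (auto simp: indicator_def)
  have "has_bochner_integral lborel (\<lambda>x. h x * indicator {0..1} x) (S 1 - S 0)"
    using smooth_fun_continuous_on[OF h(1), of UNIV]
    by (intro has_bochner_integral_FTC_Icc_real h(2)) (auto simp: continuous_on_eq_continuous_at)
  then have h_int: "integrable lborel h" "(\<integral>x. h x \<partial>lborel) = 1"
    by (simp_all add: h_ind S0 S1 has_bochner_integral_iff)
  define \<phi> where "\<phi> = (\<lambda>n x. S (real n * x + - (real n * p)) - S (real n * x + - (real n * q)))"
  define F where "F = (\<lambda>x. indicator {a<..<b} x * f x)"
  define G where "G = (\<lambda>x. indicator {a<..<b} x * g x)"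
  have smooth: "smooth_fun (\<phi> n)" for n
    unfolding \<phi>_def by (intro smooth_fun_diff smooth_fun_affine S)
  have deriv_\<phi>: "deriv (\<phi> n) x = real n * h (real n * (x - p)) - real n * h (real n * (x - q))" for n x
  proof (rule DERIV_imp_deriv)
    have "((\<lambda>x. S (real n * x + - (real n * c))) has_real_derivative h (real n * x + - (real n * c)) * real n) (at x)" for c
      by (rule DERIV_chain2[OF h(2)]) (auto intro!: derivative_eq_intros)
    from DERIV_diff[OF this[of p] this[of q]]
    show "(\<phi> n has_real_derivative real n * h (real n * (x - p)) - real n * h (real n * (x - q))) (at x)"
      by (simp add: \<phi>_def algebra_simps)
  qed
  \<comment> \<open>The support lies in [p, q + 1/n], which is inside (a, b) for large n because q <
    b.\<close>
  have test: "eventually (\<lambda>n. test_function a b (\<phi> n)) sequentially"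
  proof -
    have "(\<lambda>n. q + 1 / real n) \<longlonglongrightarrow> q + 0" by (intro tendsto_intros lim_1_over_n)
    then have "eventually (\<lambda>n. q + 1 / real n < b) sequentially"
      using pq by (intro order_tendstoD(2)) auto
    then show ?thesis using eventually_gt_at_top[of 0]
    proof eventually_elim
      case (elim n)
      have "\<phi> n x = 0" if "x \<notin> {p..q + 1 / real n}" for x
      proof (cases "x < p")
        case True
        then have "real n * x \<le> real n * p" "real n * x \<le> real n * q"
          using pq by (auto intro!: mult_left_mono)
        then show ?thesis by (simp add: \<phi>_def S0)
      next
        case False
        then have "real n * x \<ge> real n * (q + 1 / real n)"
          using that by (intro mult_left_mono) auto
        then have "real n * x \<ge> real n * q + 1" using elim by (simp add: distrib_left)
        moreover have "real n * q \<ge> real n * p" using pq by (intro mult_left_mono) auto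
        ultimately show ?thesis by (simp add: \<phi>_def S1)
      qed
      then have "closure {x. \<phi> n x \<noteq> 0} \<subseteq> {p..q + 1 / real n}"
        by (intro closure_minimal closed_atLeastAtMost) blast
      moreover from this have "compact (closure {x. \<phi> n x \<noteq> 0})"
        by (meson bounded_closed_interval bounded_subset closed_closure compact_eq_bounded_closed)
      moreover have "{p..q + 1 / real n} \<subseteq> {a<..<b}" using pq elim by auto
      moreover have "(deriv ^^ m) (\<phi> n) differentiable (at x)" for m x
        by (intro smooth_fun_differentiable smooth_fun_higher_deriv smooth)
      ultimately show ?case by (auto simp: test_function_def)
    qed
  qed
  have G: "integrable lborel G"
    using weak L2_on_set_integrable[of a b g]
    by (simp add: has_weak_deriv_L2_def set_integrable_def G_def)
  have F_meas: "F \<in> borel_measurable borel"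
    using weak by (simp add: has_weak_deriv_L2_def L2_on_def set_borel_measurable_def F_def)
  obtain M where M: "\<And>x. \<bar>F x\<bar> \<le> M"
  proof -
    have "bounded (f ` {a..b})"
      using cont by (intro compact_imp_bounded compact_continuous_image) auto
    then obtain B where "\<forall>x\<in>{a..b}. \<bar>f x\<bar> \<le> B" by (auto simp: bounded_iff)
    then have "\<bar>F x\<bar> \<le> max B 0" for x
      by (auto simp: F_def indicator_def le_max_iff_disj)
    then show ?thesis by (rule that)
  qed
  have F_cont: "isCont F c" if "c \<in> {a<..<b}" for c
  proof -
    have "continuous_on {a<..<b} f" by (rule continuous_on_subset[OF cont]) auto
    then have "continuous_on {a<..<b} F" by (rule continuous_on_eq) (simp add: F_def)
    then show ?thesis using that by (simp add: continuous_on_eq_continuous_at)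
  qed
  have cp: "isCont F p" and cq: "isCont F q" using F_cont pq by auto
  note id_p = integral_approximate_identity[OF F_meas M cp h_int(1)]
  note id_q = integral_approximate_identity[OF F_meas M cq h_int(1)]
  have "(\<lambda>n. \<integral>x. F x * deriv (\<phi> n) x \<partial>lborel) \<longlonglongrightarrow> F p - F q"
    using tendsto_diff[OF id_p(1) id_q(1)] id_p(2) id_q(2)
    by (simp add: deriv_\<phi> right_diff_distrib h_int(2))
  moreover have "(\<lambda>n. \<integral>x. G x * \<phi> n x \<partial>lborel) \<longlonglongrightarrow> (\<integral>x. indicator {p<..q} x * G x \<partial>lborel)"
  proof (rule integral_dominated_convergence)
    have [measurable]: "G \<in> borel_measurable borel" using G by auto
    have [measurable]: "\<phi> n \<in> borel_measurable borel" for n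
      by (intro borel_measurable_continuous_onI smooth_fun_continuous_on smooth)
    show "(\<lambda>x. indicator {p<..q} x * G x) \<in> borel_measurable lborel"
      "(\<lambda>x. G x * \<phi> n x) \<in> borel_measurable lborel" for n
      by simp_all
    show "integrable lborel (\<lambda>x. \<bar>G x\<bar>)" using G by simp
    have "\<bar>\<phi> n x\<bar> \<le> 1" for n x
      unfolding \<phi>_def using S_nonneg S_le by (smt (verit))
    then show "AE x in lborel. norm (G x * \<phi> n x) \<le> \<bar>G x\<bar>" for n
      by (simp add: abs_mult mult_left_le)
    \<comment> \<open>At x = c the value is S 0 = 0 for every n, so the limit is the indicator of
      the open ray; this is why the half-open interval (p, q] appears.\<close>
    have step: "(\<lambda>n. S (real n * x + - (real n * c))) \<longlonglongrightarrow> indicator {c<..} x" for c x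
    proof (cases "x > c")
      case True
      then have "eventually (\<lambda>n. 1 / (x - c) \<le> real n) sequentially"
        using filterlim_real_sequentially by (simp add: filterlim_at_top)
      then have "eventually (\<lambda>n. 1 = S (real n * x + - (real n * c))) sequentially"
        by eventually_elim (use True in \<open>simp add: S1 field_simps\<close>)
      then show ?thesis using True by (auto intro: Lim_transform_eventually[OF tendsto_const])
    next
      case False
      then have "real n * x \<le> real n * c" for n by (intro mult_left_mono) auto
      then show ?thesis using False by (simp add: S0)
    qed
    have "(\<lambda>n. G x * \<phi> n x) \<longlonglongrightarrow> G x * (indicator {p<..} x - indicator {q<..} x)" for x
      unfolding \<phi>_def by (intro tendsto_intros step)
    moreover have "indicator {p<..} x - indicator {q<..} x = (indicator {p<..q} x :: real)" for x
      using pq by (auto simp: indicator_def)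
    ultimately show "AE x in lborel. (\<lambda>n. G x * \<phi> n x) \<longlonglongrightarrow> indicator {p<..q} x * G x"
      by (simp add: mult.commute)
  qed
  moreover have "eventually (\<lambda>n. (\<integral>x. F x * deriv (\<phi> n) x \<partial>lborel) = - (\<integral>x. G x * \<phi> n x \<partial>lborel)) sequentially"
    using test
  proof eventually_elim
    case (elim n)
    then show ?case
      using weak by (simp add: has_weak_deriv_L2_def set_lebesgue_integral_def F_def G_def mult.assoc)
  qed
  ultimately have "F p - F q = - (\<integral>x. indicator {p<..q} x * G x \<partial>lborel)"
    using Lim_transform_eventually LIMSEQ_unique tendsto_minus by fast
  then show ?thesis
    using pq by (simp add: F_def G_def set_lebesgue_integral_def)
qed

text \<open>The difference of \<open>f\<close> and the indefinite integral of the weak derivative is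
  constant on the open interval and continuous on the closed one, hence constant there; its value at
  \<open>a\<close> is f(a). The gauge integral is used because the second mean value theorem is
  stated for it.\<close>

lemma weak_deriv_has_integral:
  assumes weak: "has_weak_deriv_L2 a b f g" and cont: "continuous_on {a..b} f"
    and "a < b" "t \<in> {a..b}"
  shows "((\<lambda>x. indicator {a<..<b} x * g x) has_integral (f t - f a)) {a..t}"
proof -
  define G where "G = (\<lambda>x. indicator {a<..<b} x * g x)"
  have "integrable lborel G"
    using weak L2_on_set_integrable[of a b g]
    by (simp add: has_weak_deriv_L2_def set_integrable_def G_def)
  then have G_set: "set_integrable lborel A G" if "A \<in> sets lborel" for A
    using integrable_mult_indicator[OF that] by (simp only: set_integrable_def)
  note G = set_borel_integral_eq_integral[OF G_set]
  define D where "D = (\<lambda>x. f x - integral {a..x} G)"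
  have const: "D p = D q" if "a < p" "p < q" "q < b" for p q
  proof -
    have "f q - f p = (LBINT x:{p<..q}. G x)"
      using weak_deriv_integral_open[OF weak cont that] by (simp add: G_def)
    also have "\<dots> = (LBINT x:{p..q}. G x)"
      by (rule set_integral_discrete_difference[of "{p}"]) auto
    also have "\<dots> = integral {p..q} G" by (rule G) simp
    also have "integral {a..p} G + integral {p..q} G = integral {a..q} G"
      using that G(1) by (intro Henstock_Kurzweil_Integration.integral_combine) auto
    finally show ?thesis by (simp add: D_def)
  qed
  obtain m where m: "a < m" "m < b" using dense[OF \<open>a < b\<close>] by blast
  have "D x = D m" if "x \<in> {a<..<b}" for x
    using that m const[of x m] const[of m x, symmetric]
    by (cases x m rule: linorder_cases) simp_all
  moreover have "continuous_on (closure {a<..<b}) D"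
    using \<open>a < b\<close> cont unfolding D_def
    by (auto intro!: continuous_intros indefinite_integral_continuous_1 G)
  ultimately have "D x = D m" if "x \<in> {a..b}" for x
    using continuous_constant_on_closure[of "{a<..<b}" D "D m" x] that \<open>a < b\<close> by simp
  from this[of t] this[of a] have "integral {a..t} G = f t - f a"
    using assms by (simp add: D_def)
  with G(1)[of "{a..t}"] show ?thesis
    by (simp add: G_def has_integral_iff)
qed

section \<open>The extremum estimate\<close>

theorem lemma2p1:
  fixes a b \<alpha> t0 :: real and B f :: "real \<Rightarrow> real"
  assumes "a < b" and "0 < \<alpha>" and "\<alpha> < 1"
    and B_pos: "\<And>x. x \<in> {0..1} \<Longrightarrow> B x > 0" and "B 0 = 1" and "B 1 = 1"
    and "f \<in> sobolev_H1 a b" and "continuous_on {a..b} f"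
    and "t0 \<in> {a..b}" and max: "\<And>t. t \<in> {a..b} \<Longrightarrow> f t \<le> f t0"
  shows "abc_caputo B \<alpha> a b f t0 \<ge>
           B \<alpha> / (1 - \<alpha>) * mittag_leffler \<alpha> (- (\<alpha> / (1 - \<alpha>)) * (t0 - a) powr \<alpha>) * (f t0 - f a) \<and>
         B \<alpha> / (1 - \<alpha>) * mittag_leffler \<alpha> (- (\<alpha> / (1 - \<alpha>)) * (t0 - a) powr \<alpha>) * (f t0 - f a) \<ge> 0"
proof -
  define g where "g = weak_deriv a b f"
  define G where "G = (\<lambda>x. indicator {a<..<b} x * g x)"
  define k where "k = (\<lambda>s. mittag_leffler \<alpha> (- (\<alpha> / (1 - \<alpha>)) * (t0 - s) powr \<alpha>))"
  have weak: "has_weak_deriv_L2 a b f g"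
    using \<open>f \<in> sobolev_H1 a b\<close> unfolding sobolev_H1_def weak_deriv_def g_def
    by (metis (mono_tags, lifting) mem_Collect_eq someI)
  have t0: "a \<le> t0" "t0 \<le> b" using \<open>t0 \<in> {a..b}\<close> by auto
  have C_pos: "B \<alpha> / (1 - \<alpha>) > 0" using assms by simp
  have k_mono: "k x \<le> k y" if "x \<le> y" "y \<le> t0" for x y
    using mittag_leffler_minus_antimono[of \<alpha> "\<alpha> / (1 - \<alpha>) * (t0 - y) powr \<alpha>" "\<alpha> / (1 - \<alpha>) * (t0 - x) powr \<alpha>"]
      that assms(2,3) by (simp add: k_def mult_left_mono divide_right_mono powr_mono2)
  have k_nonneg: "0 \<le> k x" for x
    using mittag_leffler_minus_nonneg[of \<alpha> "\<alpha> / (1 - \<alpha>) * (t0 - x) powr \<alpha>"] assms(2,3)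
    by (simp add: k_def)
  have G_integral: "(G has_integral (f t - f a)) {a..t}" if "t \<in> {a..b}" for t
    unfolding G_def using weak_deriv_has_integral[OF weak] assms that by simp
  have G_int: "integrable lborel G"
    using weak L2_on_set_integrable[of a b g]
    by (simp add: has_weak_deriv_L2_def set_integrable_def G_def)
  have [measurable]: "k \<in> borel_measurable borel"
    unfolding k_def mittag_leffler_def by measurable
  \<comment> \<open>On [a, t0] the kernel lies between 0 and its value at \<open>t0\<close>.
    Lebesgue integrability of the product lets the gauge integral be identified with the one in
    \<open>abc_caputo\<close>.\<close>
  have kG_int: "set_integrable lborel {a..t0} (\<lambda>s. k s * G s)"
    unfolding set_integrable_def
  proof (rule Bochner_Integration.integrable_bound)
    show "integrable lborel (\<lambda>s. k t0 * G s)" using G_int by simp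
    have "indicator {a..t0} s * k s \<le> k t0" for s
      using k_mono[of s t0] k_nonneg[of t0] by (simp add: indicator_def)
    then show "AE s in lborel. norm (indicator {a..t0} s *\<^sub>R (k s * G s)) \<le> norm (k t0 * G s)"
      using k_nonneg by (intro AE_I2) (simp add: abs_mult mult.assoc[symmetric] mult_right_mono)
    show "(\<lambda>s. indicator {a..t0} s *\<^sub>R (k s * G s)) \<in> borel_measurable lborel"
      using borel_measurable_integrable[OF G_int] by simp
  qed
  obtain c where c: "c \<in> {a..t0}"
    and smv: "integral {a..t0} (\<lambda>s. k s * G s) = k a * integral {a..c} G + k t0 * integral {c..t0} G"
    using second_mean_value_theorem[of G a t0 k] G_integral[OF \<open>t0 \<in> {a..b}\<close>] t0 k_mono
    by (metis has_integral_integrable)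
  have cb: "c \<in> {a..b}" using c t0 by auto
  have ac: "integral {a..c} G = f c - f a"
    using G_integral[OF cb] by (rule integral_unique)
  have "integral {a..c} G + integral {c..t0} G = integral {a..t0} G"
    using c G_integral[OF \<open>t0 \<in> {a..b}\<close>]
    by (intro Henstock_Kurzweil_Integration.integral_combine) (auto intro: has_integral_integrable)
  then have ct: "integral {c..t0} G = f t0 - f c"
    using ac integral_unique[OF G_integral[OF \<open>t0 \<in> {a..b}\<close>]] by simp
  \<comment> \<open>Maximality at \<open>t0\<close> makes the increment after \<open>c\<close>
    nonnegative, so its weight may be lowered from \<open>k t0\<close> to \<open>k a\<close>; the
    increments then telescope to f(t0) - f(a).\<close>
  have "k a * (f t0 - f c) \<le> k t0 * (f t0 - f c)"
    using max[OF cb] k_mono[of a t0] t0 by (intro mult_right_mono) auto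
  then have "k a * (f t0 - f a) \<le> integral {a..t0} (\<lambda>s. k s * G s)"
    unfolding smv ac ct by (simp add: algebra_simps)
  also have "\<dots> = (LBINT s:{a..t0}. k s * G s)"
    by (rule set_borel_integral_eq_integral(2)[OF kG_int, symmetric])
  \<comment> \<open>On [a, t0] the cut-off \<open>G\<close> and \<open>g\<close> can differ only at
    \<open>a\<close> and, if t0 = b, at \<open>b\<close>.\<close>
  also have "\<dots> = (LBINT s:{a..t0}. k s * g s)"
    unfolding set_lebesgue_integral_def
    by (rule integral_discrete_difference[of "{a, b}"])
       (use t0 in \<open>auto simp: G_def indicator_def\<close>)
  finally have "B \<alpha> / (1 - \<alpha>) * (k a * (f t0 - f a)) \<le> abc_caputo B \<alpha> a b f t0"
    unfolding abc_caputo_def k_def g_def using C_pos by (intro mult_left_mono) auto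
  moreover have "0 \<le> B \<alpha> / (1 - \<alpha>) * (k a * (f t0 - f a))"
    using C_pos k_nonneg[of a] max[of a] \<open>a < b\<close>
    by (intro mult_nonneg_nonneg) auto
  ultimately show ?thesis by (simp add: k_def mult.assoc)
qed

end
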